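(* Let $(K,\leq)$ be a pathwise connected poset and let $a\in K$. Then there is an isomorphism of groups $H_1(K,\mathbb{Z})\simeq \pi_1(K,a)_{ab}$, where $\pi_1(K,a)_{ab}$ is the Abelianization of the homotopy group $\pi_1(K,a)$ of the poset and $H_1(K,\mathbb{Z})$ is its first net homology group.
   Context: Simplices of a poset $K$: a $0$-simplex is an element of $K$. A $1$-simplex $b=(|b|;\partial_0b,\partial_1b)$ consists of elements $|b|$ (the support), $\partial_0b,\partial_1b$ of $K$ with $\partial_0b,\partial_1b\leq|b|$. A $2$-simplex $c$ consists of $1$-simplices $\partial_0c,\partial_1c,\partial_2c$ and a support $|c|\in K$ with $|\partial_ic|\leq|c|$, satisfying the face identities $\partial_0\partial_1c=\partial_0\partial_0c$, $\partial_0\partial_2c=\partial_1\partial_0c$, $\partial_1\partial_2c=\partial_1\partial_1c$. The set of $n$-simplices is denoted $\widetilde\Sigma_n(K)$. Homotopy: a path is $p=b_n*\cdots*b_1$, $b_i\in\widetilde\Sigma_1(K)$, $\partial_0b_i=\partial_1b_{i+1}$; it goes from $\partial_1b_1$ to $\partial_0b_n$. $K$ is pathwise connected if any two elements are joined by a path. Homotopy of paths is the equivalence relation generated by replacing a $1$-simplex $\partial_1c$ of a path by $\partial_0c*\partial_2c$, or conversely, for $c\in\widetilde\Sigma_2(K)$. $\pi_1(K,a)$ is the group of homotopy classes of closed paths from $a$ to $a$ under concatenation $*$, with identity the class of $\sigma_0a=(a;a,a)$ and inverse given by the reverse path, where the reverse of $b$ is $\overline b=(|b|;\partial_1b,\partial_0b)$.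 Net homology: $C_n(K,\mathbb{Z})$ is the free Abelian group on $\widetilde\Sigma_n(K)$; $\mathrm{b}_n:C_n(K,\mathbb{Z})\to C_{n-1}(K,\mathbb{Z})$ is the linear map with $\mathrm{b}_nx=\sum_{k=0}^n(-1)^k\partial_kx$; $H_1(K,\mathbb{Z})=\ker\mathrm{b}_1/\mathrm{b}_2(C_2(K,\mathbb{Z}))$. *)

theory Defs
  imports "HOL-Algebra.Free_Abelian_Groups" "HOL-Algebra.Generated_Groups"
begin

text \<open>A poset is a carrier set \<open>K\<close> together with a relation \<open>r\<close> satisfying
  \<open>partial_order_on K r\<close>, where \<open>(x, y) \<in> r\<close> means \<open>x \<le> y\<close>.\<close>

section \<open>Simplices of a poset\<close>

datatype 'a simplex1 = Simplex1 (supp1: 'a) (vert0: 'a) (vert1: 'a)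

datatype 'a simplex2 =
  Simplex2 (supp2: 'a) (face0: "'a simplex1") (face1: "'a simplex1") (face2: "'a simplex1")

definition simplices0 :: "'a set \<Rightarrow> 'a rel \<Rightarrow> 'a set" where
  "simplices0 K r = K"

definition simplices1 :: "'a set \<Rightarrow> 'a rel \<Rightarrow> 'a simplex1 set" where
  "simplices1 K r = {b. supp1 b \<in> K \<and> vert0 b \<in> K \<and> vert1 b \<in> K \<and>
     (vert0 b, supp1 b) \<in> r \<and> (vert1 b, supp1 b) \<in> r}"

definition simplices2 :: "'a set \<Rightarrow> 'a rel \<Rightarrow> 'a simplex2 set" where
  "simplices2 K r = {c. supp2 c \<in> K \<and>
     face0 c \<in> simplices1 K r \<and> face1 c \<in> simplices1 K r \<and> face2 c \<in> simplices1 K r \<and>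
     (supp1 (face0 c), supp2 c) \<in> r \<and> (supp1 (face1 c), supp2 c) \<in> r \<and>
     (supp1 (face2 c), supp2 c) \<in> r \<and>
     vert0 (face1 c) = vert0 (face0 c) \<and>
     vert0 (face2 c) = vert1 (face0 c) \<and>
     vert1 (face2 c) = vert1 (face1 c)}"

definition degen0 :: "'a \<Rightarrow> 'a simplex1" where
  "degen0 a = Simplex1 a a a"

section \<open>Paths and the homotopy group\<close>

text \<open>The path \<open>b\<^sub>n * \<dots> * b\<^sub>1\<close> is the nonempty list \<open>[b\<^sub>n, \<dots>, b\<^sub>1]\<close>, so that the
  first 1-simplex traversed is the last list entry and \<open>p * q\<close> is \<open>p @ q\<close>.\<close>

definition path :: "'a set \<Rightarrow> 'a rel \<Rightarrow> 'a simplex1 list \<Rightarrow> bool" where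
  "path K r p \<longleftrightarrow> p \<noteq> [] \<and> set p \<subseteq> simplices1 K r \<and>
     successively (\<lambda>b' b. vert0 b = vert1 b') p"

definition path_start :: "'a simplex1 list \<Rightarrow> 'a" where
  "path_start p = vert1 (last p)"

definition path_end :: "'a simplex1 list \<Rightarrow> 'a" where
  "path_end p = vert0 (hd p)"

definition pathwise_connected :: "'a set \<Rightarrow> 'a rel \<Rightarrow> bool" where
  "pathwise_connected K r \<longleftrightarrow>
     (\<forall>x\<in>K. \<forall>y\<in>K. \<exists>p. path K r p \<and> path_start p = x \<and> path_end p = y)"

text \<open>If the left-hand list is a path, then by the face identities so is the right-hand one,
  with the same endpoints, and conversely. Hence every homotopy class consists of paths with
  common endpoints.\<close>

inductive elementary_deformation ::
  "'a set \<Rightarrow> 'a rel \<Rightarrow> 'a simplex1 list \<Rightarrow> 'a simplex1 list \<Rightarrow> bool" for K r where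
  "\<lbrakk>path K r (p @ [face1 c] @ q); c \<in> simplices2 K r\<rbrakk> \<Longrightarrow>
     elementary_deformation K r (p @ [face1 c] @ q) (p @ [face0 c, face2 c] @ q)"

definition homotopy :: "'a set \<Rightarrow> 'a rel \<Rightarrow> 'a simplex1 list rel" where
  "homotopy K r = {(p, q). path K r p \<and> path K r q \<and> equivclp (elementary_deformation K r) p q}"

definition loops :: "'a set \<Rightarrow> 'a rel \<Rightarrow> 'a \<Rightarrow> 'a simplex1 list set" where
  "loops K r a = {p. path K r p \<and> path_start p = a \<and> path_end p = a}"

text \<open>Inverses are not part of the record: they are determined by the product, the inverse of a
  class being the class of the reverse path.\<close>

definition homotopy_group :: "'a set \<Rightarrow> 'a rel \<Rightarrow> 'a \<Rightarrow> 'a simplex1 list set monoid" where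
  "homotopy_group K r a =
     \<lparr>carrier = loops K r a // homotopy K r,
      mult = (\<lambda>X Y. \<Union>p\<in>X. \<Union>q\<in>Y. homotopy K r `` {p @ q}),
      one = homotopy K r `` {[degen0 a]}\<rparr>"

definition abelianization :: "('g, 'm) monoid_scheme \<Rightarrow> 'g set monoid" where
  "abelianization G = G Mod (derived G (carrier G))"

section \<open>Net homology\<close>

abbreviation chains0 :: "'a set \<Rightarrow> 'a rel \<Rightarrow> ('a \<Rightarrow>\<^sub>0 int) monoid" where
  "chains0 K r \<equiv> free_Abelian_group (simplices0 K r)"

abbreviation chains1 :: "'a set \<Rightarrow> 'a rel \<Rightarrow> ('a simplex1 \<Rightarrow>\<^sub>0 int) monoid" where
  "chains1 K r \<equiv> free_Abelian_group (simplices1 K r)"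

abbreviation chains2 :: "'a set \<Rightarrow> 'a rel \<Rightarrow> ('a simplex2 \<Rightarrow>\<^sub>0 int) monoid" where
  "chains2 K r \<equiv> free_Abelian_group (simplices2 K r)"

definition boundary1 :: "('a simplex1 \<Rightarrow>\<^sub>0 int) \<Rightarrow> ('a \<Rightarrow>\<^sub>0 int)" where
  "boundary1 = frag_extend (\<lambda>b. frag_of (vert0 b) - frag_of (vert1 b))"

definition boundary2 :: "('a simplex2 \<Rightarrow>\<^sub>0 int) \<Rightarrow> ('a simplex1 \<Rightarrow>\<^sub>0 int)" where
  "boundary2 = frag_extend (\<lambda>c. frag_of (face0 c) - frag_of (face1 c) + frag_of (face2 c))"

definition cycles1 :: "'a set \<Rightarrow> 'a rel \<Rightarrow> ('a simplex1 \<Rightarrow>\<^sub>0 int) set" where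
  "cycles1 K r = kernel (chains1 K r) (chains0 K r) boundary1"

definition boundaries1 :: "'a set \<Rightarrow> 'a rel \<Rightarrow> ('a simplex1 \<Rightarrow>\<^sub>0 int) set" where
  "boundaries1 K r = boundary2 ` carrier (chains2 K r)"

definition net_homology1 :: "'a set \<Rightarrow> 'a rel \<Rightarrow> ('a simplex1 \<Rightarrow>\<^sub>0 int) set monoid" where
  "net_homology1 K r = (chains1 K r)\<lparr>carrier := cycles1 K r\<rparr> Mod boundaries1 K r"

end

theory Submission
  imports Defs
begin

text \<open>Choose for every vertex \<open>x\<close> a path \<open>\<gamma> x\<close> from the base point to \<open>x\<close>. Sending a
  1-simplex \<open>b\<close> to the class of the loop that runs along \<open>\<gamma>\<close> to the start of \<open>b\<close>, along \<open>b\<close>, and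
  back along \<open>\<gamma>\<close> extends to a homomorphism \<open>\<phi>\<close> from the 1-chains to the Abelianized homotopy group.
  It maps the chain of a loop to the class of that loop, so it is onto already on cycles, and it
  kills boundaries because the faces of a 2-simplex are homotopic paths. Conversely, the loops
  attached to the simplices of a cycle \<open>z\<close> concatenate to a loop whose chain is homologous to \<open>z\<close>,
  as the contributions of \<open>\<gamma>\<close> add up to the image of the boundary of \<open>z\<close>. If \<open>\<phi> z\<close> is trivial,
  this loop is a product of commutators up to homotopy, hence \<open>z\<close> is a boundary.\<close>

section \<open>Paths and homotopy\<close>

definition reverse1 :: "'a simplex1 \<Rightarrow> 'a simplex1" where
  "reverse1 b = Simplex1 (supp1 b) (vert1 b) (vert0 b)"

definition reverse_path :: "'a simplex1 list \<Rightarrow> 'a simplex1 list" where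
  "reverse_path p = map reverse1 (rev p)"

text \<open>The Hurewicz map at the level of chains: passing to the sum forgets the order in which
  the simplices are traversed.\<close>

definition path_chain :: "'a simplex1 list \<Rightarrow> ('a simplex1 \<Rightarrow>\<^sub>0 int)" where
  "path_chain p = (\<Sum>b\<leftarrow>p. frag_of b)"

section \<open>Reversal, endpoints and concatenation\<close>

lemma reverse1_simps [simp]:
  "supp1 (reverse1 b) = supp1 b" "vert0 (reverse1 b) = vert1 b" "vert1 (reverse1 b) = vert0 b"
  "reverse1 (reverse1 b) = b"
  by (simp_all add: reverse1_def)

lemma reverse1_in_simplices1 [simp]: "reverse1 b \<in> simplices1 K r \<longleftrightarrow> b \<in> simplices1 K r"
  by (auto simp: simplices1_def)

lemma reverse_path_simps [simp]:
  "reverse_path [] = []"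
  "reverse_path [b] = [reverse1 b]"
  "reverse_path (b # p) = reverse_path p @ [reverse1 b]"
  "reverse_path (p @ q) = reverse_path q @ reverse_path p"
  "reverse_path (reverse_path p) = p"
  "reverse_path p = [] \<longleftrightarrow> p = []"
  by (simp_all add: reverse_path_def rev_map o_def)

lemma path_chain_simps [simp]:
  "path_chain [] = 0"
  "path_chain (b # p) = frag_of b + path_chain p"
  "path_chain (p @ q) = path_chain p + path_chain q"
  by (simp_all add: path_chain_def)

lemma path_start_simps [simp]:
  "path_start [b] = vert1 b"
  "p \<noteq> [] \<Longrightarrow> path_start (b # p) = path_start p"
  "q \<noteq> [] \<Longrightarrow> path_start (p @ q) = path_start q"
  "p \<noteq> [] \<Longrightarrow> path_start (reverse_path p) = path_end p"
  by (simp_all add: path_start_def path_end_def reverse_path_def last_map last_rev)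

lemma path_end_simps [simp]:
  "path_end (b # p) = vert0 b"
  "p \<noteq> [] \<Longrightarrow> path_end (p @ q) = path_end p"
  "p \<noteq> [] \<Longrightarrow> path_end (reverse_path p) = path_start p"
  by (simp_all add: path_start_def path_end_def reverse_path_def hd_map hd_rev)

lemma path_nonempty: "path K r p \<Longrightarrow> p \<noteq> []"
  by (simp add: path_def)

lemma path_single [simp]: "path K r [b] \<longleftrightarrow> b \<in> simplices1 K r"
  by (simp add: path_def)

lemma path_append [simp]:
  "\<lbrakk>p \<noteq> []; q \<noteq> []\<rbrakk> \<Longrightarrow>
    path K r (p @ q) \<longleftrightarrow> path K r p \<and> path K r q \<and> path_start p = path_end q"
  by (auto simp: path_def path_start_def path_end_def successively_append_iff)

lemma path_Cons [simp]:
  "q \<noteq> [] \<Longrightarrow> path K r (b # q) \<longleftrightarrow> b \<in> simplices1 K r \<and> path K r q \<and> vert1 b = path_end q"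
  using path_append[of "[b]" q K r] by simp

lemma path_reverse_path [simp]: "path K r (reverse_path p) \<longleftrightarrow> path K r p"
proof -
  have "path K r (reverse_path p)" if "path K r p" for p
    using that
    by (auto simp: path_def reverse_path_def successively_map elim!: successively_mono)
  from this[of p] this[of "reverse_path p"] show ?thesis by auto
qed

lemma path_in_simplices0:
  assumes "path K r p" shows "path_start p \<in> K" "path_end p \<in> K"
proof -
  have "last p \<in> simplices1 K r" "hd p \<in> simplices1 K r"
    using assms last_in_set[of p] hd_in_set[of p] by (auto simp: path_def)
  then show "path_start p \<in> K" "path_end p \<in> K"
    by (simp_all add: simplices1_def path_start_def path_end_def)
qed

text \<open>The surroundings see a middle segment only through its endpoints. The case split is
  there because \<open>path_append\<close> speaks of nonempty lists.\<close>

lemma path_context_replace: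
  assumes "path K r (u @ p @ v)" "path K r p" "path K r q"
    and "path_start p = path_start q" "path_end p = path_end q"
  shows "path K r (u @ q @ v)"
  using assms by (cases "u = []"; cases "v = []") (simp_all add: path_nonempty)

section \<open>Deformations and homotopy of paths\<close>

lemma elementary_deformation_paths:
  assumes "elementary_deformation K r p q"
  shows "path K r p \<and> path K r q \<and> path_start p = path_start q \<and> path_end p = path_end q"
  using assms
proof cases
  case (1 u c v)
  \<comment> \<open>The three face identities: one makes \<open>face0 c\<close> and
    \<open>face2 c\<close> composable, the other two match the endpoints with those of
    \<open>face1 c\<close>.\<close>
  have f: "path K r [face1 c]" "path K r [face0 c, face2 c]"
    "path_start [face1 c] = path_start [face0 c, face2 c]"
    "path_end [face1 c] = path_end [face0 c, face2 c]"
    using \<open>c \<in> simplices2 K r\<close> by (simp_all add: simplices2_def)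
  have "path_start (u @ [face1 c] @ v) = path_start (u @ [face0 c, face2 c] @ v)"
    using f(3) by (cases "v = []") simp_all
  moreover have "path_end (u @ [face1 c] @ v) = path_end (u @ [face0 c, face2 c] @ v)"
    using f(4) by (cases "u = []") simp_all
  ultimately show ?thesis
    using 1 path_context_replace[OF 1(3) f] by simp
qed

lemma elementary_deformation_context:
  assumes "elementary_deformation K r p q" "path K r (u @ p @ v)"
  shows "elementary_deformation K r (u @ p @ v) (u @ q @ v)"
  using assms(1)
proof cases
  case (1 x c y)
  then show ?thesis
    using elementary_deformation.intros[of K r "u @ x" c "y @ v"] assms(2) by simp
qed

lemma elementary_deformation_homotopy:
  "elementary_deformation K r p q \<Longrightarrow> (p, q) \<in> homotopy K r"
  by (simp add: homotopy_def elementary_deformation_paths r_into_equivclp)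

lemma homotopy_face:
  assumes "c \<in> simplices2 K r"
  shows "([face1 c], [face0 c, face2 c]) \<in> homotopy K r"
proof (rule elementary_deformation_homotopy)
  have "path K r ([] @ [face1 c] @ [])"
    using assms by (simp add: simplices2_def)
  from elementary_deformation.intros[OF this assms]
  show "elementary_deformation K r [face1 c] [face0 c, face2 c]"
    by simp
qed

lemma homotopy_refl: "path K r p \<Longrightarrow> (p, p) \<in> homotopy K r"
  by (simp add: homotopy_def)

lemma homotopy_sym: "(p, q) \<in> homotopy K r \<Longrightarrow> (q, p) \<in> homotopy K r"
  by (auto simp: homotopy_def intro: equivclp_sym)

lemma homotopy_trans [trans]:
  "\<lbrakk>(p, q) \<in> homotopy K r; (q, s) \<in> homotopy K r\<rbrakk> \<Longrightarrow> (p, s) \<in> homotopy K r"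
  by (auto simp: homotopy_def intro: equivclp_trans)

text \<open>Induction along a chain of deformations, each taken in either direction. Carrying
  \<open>(p, y) \<in> homotopy K r\<close> along keeps every intermediate list a path homotopic to
  \<open>p\<close>.\<close>

lemma homotopy_induct [consumes 1, case_names refl step]:
  assumes "(p, q) \<in> homotopy K r"
    and "P p"
    and "\<And>y z. \<lbrakk>(p, y) \<in> homotopy K r; P y;
      elementary_deformation K r y z \<or> elementary_deformation K r z y\<rbrakk> \<Longrightarrow> P z"
  shows "P q"
proof -
  have "path K r p" "equivclp (elementary_deformation K r) p q"
    using assms(1) by (auto simp: homotopy_def)
  from this(2) have "(p, q) \<in> homotopy K r \<and> P q"
  proof (induction rule: equivclp_induct)
    case base
    then show ?case using \<open>path K r p\<close> assms(2) by (simp add: homotopy_refl)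
  next
    case (step y z)
    then have "(y, z) \<in> homotopy K r"
      using elementary_deformation_homotopy homotopy_sym by blast
    with step show ?case
      using assms(3) homotopy_trans by blast
  qed
  then show ?thesis ..
qed

lemma homotopy_paths:
  assumes "(p, q) \<in> homotopy K r"
  shows "path K r p" "path K r q" "path_start p = path_start q" "path_end p = path_end q"
proof -
  show "path K r p" "path K r q"
    using assms by (auto simp: homotopy_def)
  have "path_start p = path_start q \<and> path_end p = path_end q"
    using assms
  proof (induction rule: homotopy_induct)
    case (step y z)
    then show ?case
      by (metis elementary_deformation_paths)
  qed simp
  then show "path_start p = path_start q" "path_end p = path_end q" by simp_all
qed

text \<open>Deformations are local and keep endpoints, so each one in the chain from
  \<open>p\<close> to \<open>q\<close> can be performed between \<open>u\<close> and
  \<open>v\<close>.\<close>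

lemma homotopy_context:
  assumes "(p, q) \<in> homotopy K r" "path K r (u @ p @ v)"
  shows "(u @ p @ v, u @ q @ v) \<in> homotopy K r"
  using assms(1)
proof (induction rule: homotopy_induct)
  case refl
  then show ?case using assms(2) by (rule homotopy_refl)
next
  case (step y z)
  have y: "path K r (u @ y @ v)"
    using step.IH homotopy_paths by blast
  have "path K r (u @ z @ v)"
    using step.hyps elementary_deformation_paths path_context_replace[OF y] by metis
  with y have "(u @ y @ v, u @ z @ v) \<in> homotopy K r"
    using step.hyps elementary_deformation_context elementary_deformation_homotopy homotopy_sym
    by metis
  with step.IH show ?case by (rule homotopy_trans)
qed

text \<open>Replaces one factor at a time. This congruence makes the product of homotopy classes
  well defined.\<close>

lemma homotopy_append:
  assumes "(p, p') \<in> homotopy K r" "(q, q') \<in> homotopy K r" "path_start p = path_end q"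
  shows "(p @ q, p' @ q') \<in> homotopy K r"
proof -
  note pp = homotopy_paths[OF assms(1)] and qq = homotopy_paths[OF assms(2)]
  have "(p @ q, p' @ q) \<in> homotopy K r"
    using homotopy_context[OF assms(1), of "[]" q] pp qq assms(3) by (simp add: path_nonempty)
  also have "(p' @ q, p' @ q') \<in> homotopy K r"
    using homotopy_context[OF assms(2), of p' "[]"] pp qq assms(3) by (simp add: path_nonempty)
  finally show ?thesis .
qed

section \<open>Chains of paths\<close>

lemma keys_path_chain: "path K r p \<Longrightarrow> Poly_Mapping.keys (path_chain p) \<subseteq> simplices1 K r"
proof (induction p)
  case (Cons b p)
  then show ?case
    using keys_add[of "frag_of b" "path_chain p"] by (cases "p = []") auto
qed (simp add: path_def)

text \<open>The sum telescopes; in particular the chain of a loop is a cycle.\<close>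

lemma boundary1_path_chain:
  "path K r p \<Longrightarrow> boundary1 (path_chain p) = frag_of (path_end p) - frag_of (path_start p)"
proof (induction p)
  case (Cons b p)
  then show ?case
    by (cases "p = []") (auto simp: boundary1_def frag_extend_add)
qed (simp add: path_def)

section \<open>Boundaries\<close>

lemma boundaries1_iff:
  "x \<in> boundaries1 K r \<longleftrightarrow> (\<exists>c. Poly_Mapping.keys c \<subseteq> simplices2 K r \<and> x = boundary2 c)"
  by (simp add: boundaries1_def image_iff Bex_def)

lemma boundaries1_0: "0 \<in> boundaries1 K r"
  by (auto simp: boundaries1_iff boundary2_def intro: exI[of _ 0])

lemma boundaries1_diff:
  assumes "x \<in> boundaries1 K r" "y \<in> boundaries1 K r"
  shows "x - y \<in> boundaries1 K r"
proof -
  obtain c d where "Poly_Mapping.keys c \<subseteq> simplices2 K r" "x = boundary2 c"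
    "Poly_Mapping.keys d \<subseteq> simplices2 K r" "y = boundary2 d"
    using assms by (auto simp: boundaries1_iff)
  then show ?thesis
    using keys_diff[of c d]
    by (auto simp: boundaries1_iff boundary2_def frag_extend_diff intro!: exI[of _ "c - d"])
qed

lemma boundaries1_minus: "x \<in> boundaries1 K r \<Longrightarrow> - x \<in> boundaries1 K r"
  using boundaries1_diff[OF boundaries1_0] by simp

lemma boundaries1_add:
  "\<lbrakk>x \<in> boundaries1 K r; y \<in> boundaries1 K r\<rbrakk> \<Longrightarrow> x + y \<in> boundaries1 K r"
  using boundaries1_diff[of x K r "- y"] boundaries1_minus[of y K r] by simp

lemma boundaries1_face:
  assumes "c \<in> simplices2 K r"
  shows "frag_of (face0 c) - frag_of (face1 c) + frag_of (face2 c) \<in> boundaries1 K r"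
  unfolding boundaries1_iff using assms
  by (intro exI[of _ "frag_of c"]) (simp add: boundary2_def)

text \<open>Linearity of \<open>boundary2\<close> transports \<open>frag_induction\<close> from
  2-chains to boundaries, so claims about boundaries reduce to single 2-simplices and
  differences.\<close>

lemma boundaries1_induct [consumes 1, case_names zero face diff]:
  assumes "x \<in> boundaries1 K r"
    and "P 0"
    and "\<And>c. c \<in> simplices2 K r \<Longrightarrow> P (frag_of (face0 c) - frag_of (face1 c) + frag_of (face2 c))"
    and "\<And>x y. \<lbrakk>x \<in> boundaries1 K r; y \<in> boundaries1 K r; P x; P y\<rbrakk> \<Longrightarrow> P (x - y)"
  shows "P x"
proof -
  obtain c where "Poly_Mapping.keys c \<subseteq> simplices2 K r" and x: "x = boundary2 c"
    using assms(1) by (auto simp: boundaries1_iff)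
  \<comment> \<open>Membership is proved along with \<open>P\<close> because the \<open>diff\<close>
    case asks for it.\<close>
  from this(1) have "boundary2 c \<in> boundaries1 K r \<and> P (boundary2 c)"
    by (induction rule: frag_induction)
      (auto simp: boundary2_def frag_extend_diff boundaries1_0 assms boundaries1_face
        boundaries1_diff)
  then show ?thesis by (simp add: x)
qed

section \<open>Boundaries and cycles as subgroups of the 1-chains\<close>

lemma boundaries1_subset_chains1:
  "boundaries1 K r \<subseteq> carrier (chains1 K r)"
proof
  fix x assume "x \<in> boundaries1 K r"
  then show "x \<in> carrier (chains1 K r)"
  proof (induction rule: boundaries1_induct)
    case (face c)
    then show ?case
      using keys_add[of "frag_of (face0 c) - frag_of (face1 c)" "frag_of (face2 c)"]
        keys_diff[of "frag_of (face0 c)" "frag_of (face1 c)"]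
      by (auto simp: simplices2_def)
  next
    case (diff x y)
    then show ?case using keys_diff[of x y] by auto
  qed simp
qed

text \<open>For a single 2-simplex the six vertices of its faces cancel in pairs by the face
  identities.\<close>

lemma boundary1_boundaries1:
  "x \<in> boundaries1 K r \<Longrightarrow> boundary1 x = 0"
  by (induction rule: boundaries1_induct)
    (auto simp: boundary1_def frag_extend_diff frag_extend_add simplices2_def)

lemma subgroup_boundaries1: "subgroup (boundaries1 K r) (chains1 K r)"
proof
  fix x assume x: "x \<in> boundaries1 K r"
  then have "Poly_Mapping.keys x \<subseteq> simplices1 K r"
    using boundaries1_subset_chains1 by fastforce
  then show "inv\<^bsub>chains1 K r\<^esub> x \<in> boundaries1 K r"
    using x by (simp add: boundaries1_minus)
qed (use boundaries1_subset_chains1 in \<open>auto intro: boundaries1_0 boundaries1_add\<close>)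

lemma hom_boundary1: "boundary1 \<in> hom (chains1 K r) (chains0 K r)"
proof (rule homI)
  fix x assume "x \<in> carrier (chains1 K r)"
  then have "Poly_Mapping.keys x \<subseteq> simplices1 K r" by simp
  then have "Poly_Mapping.keys (boundary1 x) \<subseteq> simplices0 K r"
  proof (induction rule: frag_induction)
    case (one b)
    then show ?case
      using keys_diff[of "frag_of (vert0 b)" "frag_of (vert1 b)"]
      by (auto simp: boundary1_def simplices1_def simplices0_def)
  next
    case (diff x y)
    then show ?case
      using keys_diff[of "boundary1 x" "boundary1 y"]
      by (auto simp: boundary1_def frag_extend_diff)
  qed (simp add: boundary1_def)
  then show "boundary1 x \<in> carrier (chains0 K r)" by simp
qed (simp add: boundary1_def frag_extend_add)

lemma cycles1_iff:
  "z \<in> cycles1 K r \<longleftrightarrow> Poly_Mapping.keys z \<subseteq> simplices1 K r \<and> boundary1 z = 0"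
  by (simp add: cycles1_def kernel_def)

lemma subgroup_cycles1: "subgroup (cycles1 K r) (chains1 K r)"
  unfolding cycles1_def
  by (intro group_hom.subgroup_kernel group_hom.intro group_hom_axioms.intro hom_boundary1) simp_all

lemma boundaries1_subset_cycles1: "boundaries1 K r \<subseteq> cycles1 K r"
  using boundaries1_subset_chains1[of K r] by (auto simp: cycles1_iff boundary1_boundaries1 subset_iff)

text \<open>An elementary deformation changes the chain by exactly the boundary of its 2-simplex;
  deformations run backwards contribute the negative.\<close>

lemma path_chain_homotopy:
  assumes "(p, q) \<in> homotopy K r"
  shows "path_chain p - path_chain q \<in> boundaries1 K r"
  using assms
proof (induction rule: homotopy_induct)
  case refl
  then show ?case by (simp add: boundaries1_0)
next
  case (step y z)
  have *: "path_chain z - path_chain y \<in> boundaries1 K r" if "elementary_deformation K r y z" for y z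
    using that
  proof cases
    case (1 u c v)
    then show ?thesis using boundaries1_face[of c K r] by (simp add: algebra_simps)
  qed
  have "path_chain y - path_chain z \<in> boundaries1 K r"
    using step.hyps *[of y z] *[of z y] boundaries1_minus[of "path_chain z - path_chain y"] by auto
  from boundaries1_add[OF step.IH this] show ?case by simp
qed


section \<open>The homotopy group\<close>

definition homotopy_class :: "'a set \<Rightarrow> 'a rel \<Rightarrow> 'a simplex1 list \<Rightarrow> 'a simplex1 list set" where
  "homotopy_class K r p = homotopy K r `` {p}"

text \<open>Homotopy is reflexive on paths only; the class of a list that is not a path is empty,
  whence the hypothesis on \<open>p\<close>.\<close>

lemma homotopy_class_eq_iff:
  assumes "path K r p"
  shows "homotopy_class K r p = homotopy_class K r q \<longleftrightarrow> (p, q) \<in> homotopy K r"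
proof
  assume "homotopy_class K r p = homotopy_class K r q"
  with homotopy_refl[OF assms] have "(q, p) \<in> homotopy K r"
    by (auto simp: homotopy_class_def)
  then show "(p, q) \<in> homotopy K r" by (rule homotopy_sym)
next
  assume "(p, q) \<in> homotopy K r"
  then show "homotopy_class K r p = homotopy_class K r q"
    by (auto simp: homotopy_class_def intro: homotopy_trans homotopy_sym)
qed

lemma loops_iff:
  "p \<in> loops K r a \<longleftrightarrow> path K r p \<and> path_start p = a \<and> path_end p = a"
  by (simp add: loops_def)

lemma loops_append: "\<lbrakk>p \<in> loops K r a; q \<in> loops K r a\<rbrakk> \<Longrightarrow> p @ q \<in> loops K r a"
  using path_nonempty[of K r p] path_nonempty[of K r q] by (simp add: loops_iff)

lemma loops_reverse_path: "p \<in> loops K r a \<Longrightarrow> reverse_path p \<in> loops K r a"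
  using path_nonempty[of K r p] by (simp add: loops_iff)

lemma carrier_homotopy_group:
  "carrier (homotopy_group K r a) = homotopy_class K r ` loops K r a"
  by (auto simp: homotopy_group_def quotient_def homotopy_class_def)

lemma one_homotopy_group: "\<one>\<^bsub>homotopy_group K r a\<^esub> = homotopy_class K r [degen0 a]"
  by (simp add: homotopy_group_def homotopy_class_def)

text \<open>The product is a union over all representatives; by \<open>homotopy_append\<close> every
  member of this union is the same class, so it collapses.\<close>

lemma mult_homotopy_group:
  assumes "p \<in> loops K r a" "q \<in> loops K r a"
  shows "homotopy_class K r p \<otimes>\<^bsub>homotopy_group K r a\<^esub> homotopy_class K r q =
    homotopy_class K r (p @ q)"
proof -
  have "homotopy_class K r (p' @ q') = homotopy_class K r (p @ q)"
    if "p' \<in> homotopy_class K r p" "q' \<in> homotopy_class K r q" for p' q'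
  proof -
    have "(p @ q, p' @ q') \<in> homotopy K r"
      using that assms by (intro homotopy_append) (auto simp: homotopy_class_def loops_iff)
    then show ?thesis
      using homotopy_class_eq_iff homotopy_paths(1) by metis
  qed
  moreover have "p \<in> homotopy_class K r p" "q \<in> homotopy_class K r q"
    using assms by (simp_all add: homotopy_class_def loops_iff homotopy_refl)
  ultimately have "(\<Union>p'\<in>homotopy_class K r p. \<Union>q'\<in>homotopy_class K r q.
      homotopy_class K r (p' @ q')) = homotopy_class K r (p @ q)"
    by blast
  then show ?thesis
    by (simp add: homotopy_group_def homotopy_class_def)
qed

section \<open>Units and inverses up to homotopy\<close>

locale poset =
  fixes K :: "'a set" and r :: "'a rel"
  assumes partial_order: "partial_order_on K r"
begin

lemma refl_r [simp]: "x \<in> K \<Longrightarrow> (x, x) \<in> r"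
  using partial_order by (simp add: partial_order_on_def preorder_on_def refl_on_def)

lemma degen0_in_simplices1 [simp]: "x \<in> K \<Longrightarrow> degen0 x \<in> simplices1 K r"
  by (simp add: degen0_def simplices1_def)

lemma degen0_simps [simp]: "vert0 (degen0 x) = x" "vert1 (degen0 x) = x" "supp1 (degen0 x) = x"
  by (simp_all add: degen0_def)

lemma homotopy_degen0_left:
  assumes "path K r p"
  shows "([degen0 (path_end p)] @ p, p) \<in> homotopy K r"
proof -
  obtain b u where p: "p = b # u"
    using assms path_nonempty by (metis neq_Nil_conv)
  have b: "b \<in> simplices1 K r"
    using assms by (cases "u = []") (simp_all add: p)
  \<comment> \<open>A degenerate 2-simplex supported on \<open>supp1 b\<close> splits a unit off the
    last simplex traversed; the rest \<open>u\<close> of the path is only context.\<close>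
  have "([b], [degen0 (vert0 b), b]) \<in> homotopy K r"
    using homotopy_face[of "Simplex2 (supp1 b) (degen0 (vert0 b)) b b" K r] b
    by (simp add: simplices2_def simplices1_def)
  from homotopy_context[OF this, of "[]" u] assms show ?thesis
    by (simp add: p homotopy_sym)
qed

text \<open>Going along \<open>b\<close> and back bounds a 2-simplex with the support of
  \<open>b\<close>, whose remaining face is degenerate at the start of \<open>b\<close>.\<close>

lemma homotopy_reverse1:
  assumes "b \<in> simplices1 K r"
  shows "([reverse1 b, b], [degen0 (vert1 b)]) \<in> homotopy K r"
  using homotopy_face[of "Simplex2 (supp1 b) (reverse1 b) (degen0 (vert1 b)) b" K r] assms
  by (auto simp: simplices2_def simplices1_def intro: homotopy_sym)

text \<open>Cancellation from the inside out: the head \<open>b\<close> meets its reverse in the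
  middle, the pair contracts to a degenerate simplex, and \<open>p\<close> absorbs it.\<close>

lemma homotopy_reverse_path_left:
  "path K r p \<Longrightarrow> (reverse_path p @ p, [degen0 (path_start p)]) \<in> homotopy K r"
proof (induction p)
  case (Cons b p)
  show ?case
  proof (cases "p = []")
    case True
    then show ?thesis using Cons.prems homotopy_reverse1 by simp
  next
    case False
    then have b: "b \<in> simplices1 K r" and p: "path K r p" and e: "vert1 b = path_end p"
      using Cons.prems by simp_all
    have "(reverse_path p @ [reverse1 b, b] @ p,
        reverse_path p @ [degen0 (vert1 b)] @ p) \<in> homotopy K r"
      using homotopy_context[OF homotopy_reverse1[OF b]] b p e False by simp
    also have "(reverse_path p @ [degen0 (vert1 b)] @ p, reverse_path p @ p) \<in> homotopy K r"
      using homotopy_append[OF homotopy_refl homotopy_degen0_left[OF p], of "reverse_path p"] p e False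
      by simp
    also have "(reverse_path p @ p, [degen0 (path_start p)]) \<in> homotopy K r"
      using Cons.IH p by blast
    finally show ?thesis using False by simp
  qed
qed (simp add: path_def)

lemma homotopy_reverse_path_right:
  "path K r p \<Longrightarrow> (p @ reverse_path p, [degen0 (path_end p)]) \<in> homotopy K r"
  using homotopy_reverse_path_left[of "reverse_path p"] by (simp add: path_nonempty)

lemma degen0_in_loops: "a \<in> K \<Longrightarrow> [degen0 a] \<in> loops K r a"
  by (simp add: loops_iff)

text \<open>Associativity already holds for representatives, as concatenation of lists; unit and
  inverse need homotopies, and \<open>groupI\<close> asks for them on the left only.\<close>

lemma group_homotopy_group:
  assumes "a \<in> K"
  shows "group (homotopy_group K r a)"
proof (rule groupI)
  show "\<one>\<^bsub>homotopy_group K r a\<^esub> \<in> carrier (homotopy_group K r a)"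
    using assms by (auto simp: carrier_homotopy_group one_homotopy_group degen0_in_loops)
next
  fix X Y assume "X \<in> carrier (homotopy_group K r a)" "Y \<in> carrier (homotopy_group K r a)"
  then show "X \<otimes>\<^bsub>homotopy_group K r a\<^esub> Y \<in> carrier (homotopy_group K r a)"
    by (auto simp: carrier_homotopy_group mult_homotopy_group loops_append)
next
  fix X Y Z
  assume "X \<in> carrier (homotopy_group K r a)" "Y \<in> carrier (homotopy_group K r a)"
    "Z \<in> carrier (homotopy_group K r a)"
  then show "X \<otimes>\<^bsub>homotopy_group K r a\<^esub> Y \<otimes>\<^bsub>homotopy_group K r a\<^esub> Z =
      X \<otimes>\<^bsub>homotopy_group K r a\<^esub> (Y \<otimes>\<^bsub>homotopy_group K r a\<^esub> Z)"
    by (auto simp: carrier_homotopy_group mult_homotopy_group loops_append)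
next
  fix X assume "X \<in> carrier (homotopy_group K r a)"
  then obtain p where p: "p \<in> loops K r a" "X = homotopy_class K r p"
    by (auto simp: carrier_homotopy_group)
  have "homotopy_class K r ([degen0 a] @ p) = homotopy_class K r p"
    using homotopy_degen0_left[of p] homotopy_class_eq_iff homotopy_paths(1) p(1)
    by (metis loops_iff)
  then show "\<one>\<^bsub>homotopy_group K r a\<^esub> \<otimes>\<^bsub>homotopy_group K r a\<^esub> X = X"
    using p assms mult_homotopy_group[OF degen0_in_loops]
    by (simp add: one_homotopy_group)
  have "homotopy_class K r (reverse_path p @ p) = homotopy_class K r [degen0 a]"
    using homotopy_reverse_path_left[of p] homotopy_class_eq_iff homotopy_paths(1) p(1)
    by (metis loops_iff)
  then show "\<exists>Y\<in>carrier (homotopy_group K r a).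
      Y \<otimes>\<^bsub>homotopy_group K r a\<^esub> X = \<one>\<^bsub>homotopy_group K r a\<^esub>"
    using p mult_homotopy_group[OF loops_reverse_path[OF p(1)] p(1)] loops_reverse_path[OF p(1)]
    by (auto simp: one_homotopy_group carrier_homotopy_group)
qed

section \<open>From homotopy classes to chains modulo boundaries\<close>

lemma frag_of_degen0_boundary: "x \<in> K \<Longrightarrow> frag_of (degen0 x) \<in> boundaries1 K r"
  \<comment> \<open>All three faces are equal, so the alternating sum leaves one copy.\<close>
  using boundaries1_face[of "Simplex2 x (degen0 x) (degen0 x) (degen0 x)" K r]
  by (simp add: simplices2_def)

text \<open>The chain of the reverse path is the negative of the chain only modulo boundaries:
  \<open>p\<close> followed by its reverse contracts to a degenerate simplex, whose chain is itself
  a boundary.\<close>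

lemma path_chain_reverse_path:
  assumes "path K r p"
  shows "path_chain (reverse_path p) + path_chain p \<in> boundaries1 K r"
  using boundaries1_add[OF path_chain_homotopy[OF homotopy_reverse_path_left[OF assms]]
      frag_of_degen0_boundary[OF path_in_simplices0(1)[OF assms]]]
  by simp

text \<open>The chain map descends to a homomorphism from the homotopy group to the abelian group of
  1-chains modulo boundaries, which therefore kills the derived subgroup.\<close>

lemma path_chain_derived:
  assumes a: "a \<in> K" and p: "p \<in> loops K r a"
    and der: "homotopy_class K r p \<in> derived (homotopy_group K r a) (carrier (homotopy_group K r a))"
  shows "path_chain p \<in> boundaries1 K r"
proof -
  let ?G = "homotopy_group K r a" and ?C = "chains1 K r" and ?B = "boundaries1 K r"
  let ?Q = "?C Mod ?B"
  interpret C: comm_group ?C by (rule abelian_free_Abelian_group)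
  interpret B: normal ?B ?C
    using subgroup_boundaries1 by (simp add: C.normal_iff_subgroup)
  interpret G: group ?G using a by (rule group_homotopy_group)
  interpret Q: comm_group ?Q using subgroup_boundaries1 by (rule C.abelian_FactGroup)
  \<comment> \<open>An arbitrary representative serves, since homotopic paths have chains in the
    same coset of the boundaries.\<close>
  define \<Psi> where "\<Psi> = (\<lambda>X. ?B #>\<^bsub>?C\<^esub> path_chain (SOME p. p \<in> X))"
  have \<Psi>: "\<Psi> (homotopy_class K r q) = ?B #>\<^bsub>?C\<^esub> path_chain q" if "q \<in> loops K r a" for q
  proof -
    have "q \<in> homotopy_class K r q"
      using that by (simp add: homotopy_class_def loops_iff homotopy_refl)
    then have "(SOME p. p \<in> homotopy_class K r q) \<in> homotopy_class K r q" by (rule someI)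
    then obtain q' where q': "(SOME p. p \<in> homotopy_class K r q) = q'" "(q, q') \<in> homotopy K r"
      by (auto simp: homotopy_class_def)
    have "path_chain q' - path_chain q \<in> ?B"
      using path_chain_homotopy q'(2) homotopy_sym by blast
    then have "path_chain q' \<in> ?B #>\<^bsub>?C\<^esub> path_chain q"
      by (force simp: r_coset_def)
    then have "?B #>\<^bsub>?C\<^esub> path_chain q = ?B #>\<^bsub>?C\<^esub> path_chain q'"
      using that subgroup_boundaries1
      by (intro C.repr_independence) (simp_all add: loops_iff keys_path_chain)
    then show ?thesis by (simp add: \<Psi>_def q'(1))
  qed
  have "\<Psi> \<in> hom ?G ?Q"
  proof (rule homI)
    fix X assume "X \<in> carrier ?G"
    then obtain q where q: "q \<in> loops K r a" "X = homotopy_class K r q"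
      by (auto simp: carrier_homotopy_group)
    then show "\<Psi> X \<in> carrier ?Q"
      by (simp add: \<Psi> carrier_FactGroup loops_iff keys_path_chain)
  next
    fix X Y assume "X \<in> carrier ?G" "Y \<in> carrier ?G"
    then obtain p q where pq: "p \<in> loops K r a" "q \<in> loops K r a"
      and [simp]: "X = homotopy_class K r p" "Y = homotopy_class K r q"
      by (auto simp: carrier_homotopy_group)
    have "path_chain p \<in> carrier ?C" "path_chain q \<in> carrier ?C"
      using pq by (simp_all add: loops_iff keys_path_chain)
    from B.rcos_sum[OF this] show "\<Psi> (X \<otimes>\<^bsub>?G\<^esub> Y) = \<Psi> X \<otimes>\<^bsub>?Q\<^esub> \<Psi> Y"
      using pq by (simp add: mult_homotopy_group loops_append \<Psi>)
  qed
  then interpret \<Psi>: group_hom ?G ?Q \<Psi>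
    by unfold_locales
  \<comment> \<open>A homomorphism maps the derived subgroup onto the derived subgroup of the image,
    which is trivial in the commutative quotient.\<close>
  have "\<Psi> ` derived ?G (carrier ?G) = {\<one>\<^bsub>?Q\<^esub>}"
    using \<Psi>.derived_img[of "carrier ?G"] Q.derived_eq_singleton[of "\<Psi> ` carrier ?G"]
    using \<Psi>.hom_closed by (simp add: image_subset_iff)
  then have "\<Psi> (homotopy_class K r p) = ?B"
    using imageI[OF der, of \<Psi>] by simp
  then have "?B #>\<^bsub>?C\<^esub> path_chain p = ?B"
    using p by (simp only: \<Psi>)
  then show ?thesis
    using p subgroup_boundaries1
    by (intro C.coset_join1[of ?B "path_chain p"]) (simp_all add: loops_iff keys_path_chain)
qed

end

section \<open>Comparing cycles with loops\<close>

text \<open>The chosen path \<open>\<gamma> a\<close> is an arbitrary loop, not necessarily the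
  constant one; closing up a loop therefore conjugates it.\<close>

locale based_poset = poset K r for K :: "'a set" and r +
  fixes a :: 'a and \<gamma> :: "'a \<Rightarrow> 'a simplex1 list"
  assumes base: "a \<in> K"
    and connector: "x \<in> K \<Longrightarrow> path K r (\<gamma> x) \<and> path_start (\<gamma> x) = a \<and> path_end (\<gamma> x) = x"
begin

abbreviation \<pi> :: "'a simplex1 list set monoid" where
  "\<pi> \<equiv> homotopy_group K r a"

sublocale \<pi>: group \<pi>
  using base by (rule group_homotopy_group)

sublocale D: normal "derived \<pi> (carrier \<pi>)" \<pi>
  by (rule \<pi>.derived_self_is_normal)

sublocale ab: comm_group "abelianization \<pi>"
  unfolding abelianization_def by (rule \<pi>.derived_quot_is_comm_group)

section \<open>Classes of loops in the Abelianization\<close>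

definition ab_class :: "'a simplex1 list \<Rightarrow> 'a simplex1 list set set" where
  "ab_class p = derived \<pi> (carrier \<pi>) #>\<^bsub>\<pi>\<^esub> homotopy_class K r p"

definition close_path :: "'a simplex1 list \<Rightarrow> 'a simplex1 list" where
  "close_path p = reverse_path (\<gamma> (path_end p)) @ p @ \<gamma> (path_start p)"

lemma connector_simps [simp]:
  assumes "x \<in> K"
  shows "path K r (\<gamma> x)" "path_start (\<gamma> x) = a" "path_end (\<gamma> x) = x" "\<gamma> x \<noteq> []"
  using connector[OF assms] path_nonempty by auto

lemma homotopy_class_in_carrier: "p \<in> loops K r a \<Longrightarrow> homotopy_class K r p \<in> carrier \<pi>"
  by (simp add: carrier_homotopy_group)

lemma carrier_abelianization: "carrier (abelianization \<pi>) = ab_class ` loops K r a"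
  by (auto simp: abelianization_def carrier_FactGroup carrier_homotopy_group ab_class_def)

lemma ab_class_closed: "p \<in> loops K r a \<Longrightarrow> ab_class p \<in> carrier (abelianization \<pi>)"
  by (simp add: carrier_abelianization)

lemma ab_class_append:
  assumes "p \<in> loops K r a" "q \<in> loops K r a"
  shows "ab_class (p @ q) = ab_class p \<otimes>\<^bsub>abelianization \<pi>\<^esub> ab_class q"
  using D.rcos_sum[of "homotopy_class K r p" "homotopy_class K r q"] assms
  by (simp add: ab_class_def abelianization_def homotopy_class_in_carrier mult_homotopy_group)

lemma ab_class_homotopy: "(p, q) \<in> homotopy K r \<Longrightarrow> ab_class p = ab_class q"
  using homotopy_class_eq_iff[of K r p q] homotopy_paths(1)[of p q K r] by (simp add: ab_class_def)

lemma ab_class_degen0: "ab_class [degen0 a] = \<one>\<^bsub>abelianization \<pi>\<^esub>"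
proof -
  have "ab_class [degen0 a] = derived \<pi> (carrier \<pi>) #>\<^bsub>\<pi>\<^esub> \<one>\<^bsub>\<pi>\<^esub>"
    by (simp add: ab_class_def one_homotopy_group)
  also have "\<dots> = derived \<pi> (carrier \<pi>)"
    using D.subset by (rule \<pi>.coset_mult_one)
  finally show ?thesis by (simp add: abelianization_def)
qed

lemma ab_class_reverse_path:
  assumes "p \<in> loops K r a"
  shows "ab_class (reverse_path p) = inv\<^bsub>abelianization \<pi>\<^esub> ab_class p"
proof -
  have "ab_class (reverse_path p @ p) = \<one>\<^bsub>abelianization \<pi>\<^esub>"
    using ab_class_homotopy[OF homotopy_reverse_path_left[of p]] assms
    by (simp add: loops_iff ab_class_degen0)
  then show ?thesis
    using assms ab.inv_equality[of "ab_class (reverse_path p)" "ab_class p"]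
    by (simp add: ab_class_append loops_reverse_path ab_class_closed)
qed

text \<open>A trivial coset means that the class lies in the derived subgroup, where
  \<open>path_chain_derived\<close> applies. Injectivity on homology rests on this.\<close>

lemma path_chain_ab_class_one:
  assumes "p \<in> loops K r a" "ab_class p = \<one>\<^bsub>abelianization \<pi>\<^esub>"
  shows "path_chain p \<in> boundaries1 K r"
proof (rule path_chain_derived[OF base assms(1)])
  have "derived \<pi> (carrier \<pi>) #>\<^bsub>\<pi>\<^esub> homotopy_class K r p = derived \<pi> (carrier \<pi>)"
    using assms(2) by (simp add: ab_class_def abelianization_def)
  then show "homotopy_class K r p \<in> derived \<pi> (carrier \<pi>)"
    using homotopy_class_in_carrier[OF assms(1)] D.subgroup_axioms by (rule \<pi>.coset_join1)
qed

section \<open>Closing paths up at the base point\<close>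

lemma close_path_loop:
  assumes "path K r p"
  shows "close_path p \<in> loops K r a"
  using path_in_simplices0[OF assms] path_nonempty[OF assms] assms
  by (simp add: close_path_def loops_iff)

lemma homotopy_close_path:
  assumes "(p, q) \<in> homotopy K r"
  shows "(close_path p, close_path q) \<in> homotopy K r"
proof -
  note pq = homotopy_paths[OF assms]
  have "path K r (close_path p)"
    using close_path_loop[OF pq(1)] by (simp add: loops_iff)
  then show ?thesis
    using homotopy_context[OF assms] pq by (simp add: close_path_def)
qed

text \<open>Between the two closed paths lies an excursion from the common vertex to the base point
  and back along the same connector; it contracts.\<close>

lemma homotopy_close_path_append:
  assumes p: "path K r p" and q: "path K r q" and s: "path_start p = path_end q"
  shows "(close_path p @ close_path q, close_path (p @ q)) \<in> homotopy K r"
proof -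
  note K = path_in_simplices0[OF p] path_in_simplices0[OF q]
  note ne = path_nonempty[OF p] path_nonempty[OF q]
  let ?x = "path_end q"
  let ?u = "reverse_path (\<gamma> (path_end p)) @ p" and ?v = "q @ \<gamma> (path_start q)"
  have u: "path K r ?u" "path_start ?u = ?x" and v: "path K r ?v" "path_end ?v = ?x"
    using K ne p q s by simp_all
  have "(?u @ (\<gamma> ?x @ reverse_path (\<gamma> ?x)) @ ?v, ?u @ [degen0 ?x] @ ?v) \<in> homotopy K r"
    using homotopy_context[OF homotopy_reverse_path_right[of "\<gamma> ?x"], of ?u ?v] K ne u v by simp
  also have "(?u @ [degen0 ?x] @ ?v, ?u @ ?v) \<in> homotopy K r"
    using homotopy_append[OF homotopy_refl homotopy_degen0_left, of ?u ?v] u v ne by simp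
  finally show ?thesis
    using s ne by (simp add: close_path_def)
qed

lemma ab_class_close_path_append:
  assumes "path K r p" "path K r q" "path_start p = path_end q"
  shows "ab_class (close_path (p @ q)) =
    ab_class (close_path p) \<otimes>\<^bsub>abelianization \<pi>\<^esub> ab_class (close_path q)"
  using ab_class_homotopy[OF homotopy_close_path_append[OF assms]] assms
  by (simp add: ab_class_append close_path_loop)

text \<open>Closing up a loop conjugates it by the loop \<open>\<gamma> a\<close>, which is invisible after
  Abelianization.\<close>

lemma ab_class_close_path:
  assumes "p \<in> loops K r a"
  shows "ab_class (close_path p) = ab_class p"
proof -
  have g: "\<gamma> a \<in> loops K r a"
    using base by (simp add: loops_iff)
  have "ab_class (close_path p) = inv\<^bsub>abelianization \<pi>\<^esub> ab_class (\<gamma> a)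
      \<otimes>\<^bsub>abelianization \<pi>\<^esub> (ab_class p \<otimes>\<^bsub>abelianization \<pi>\<^esub> ab_class (\<gamma> a))"
    using assms g
    by (simp add: close_path_def ab_class_append loops_append loops_reverse_path
        ab_class_reverse_path loops_iff[of p])
  then show ?thesis
    using assms g by (simp add: ab.m_comm[of "ab_class p"] ab.inv_solve_left' ab_class_closed
        flip: ab.m_assoc)
qed

text \<open>The contributions of \<open>\<gamma> (vert1 b)\<close> cancel exactly; what is left is
  minus the chain of \<open>\<gamma> (vert0 b)\<close> together with its reverse.\<close>

lemma path_chain_close_path1:
  assumes "b \<in> simplices1 K r"
  shows "frag_of b - frag_extend (\<lambda>x. path_chain (\<gamma> x)) (boundary1 (frag_of b))
    - path_chain (close_path [b]) \<in> boundaries1 K r"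
proof -
  have v: "vert0 b \<in> K"
    using assms by (simp add: simplices1_def)
  then have "- (path_chain (reverse_path (\<gamma> (vert0 b))) + path_chain (\<gamma> (vert0 b))) \<in> boundaries1 K r"
    using path_chain_reverse_path by (intro boundaries1_minus) simp
  then show ?thesis
    by (simp add: boundary1_def close_path_def frag_extend_diff algebra_simps)
qed

end

section \<open>The homomorphism from 1-chains to the Abelianized homotopy group\<close>

locale based_poset_hom = based_poset +
  fixes \<phi>
  assumes hom_\<phi>: "\<phi> \<in> hom (chains1 K r) (abelianization \<pi>)"
    and \<phi>_simplex: "b \<in> simplices1 K r \<Longrightarrow> \<phi> (frag_of b) = ab_class (close_path [b])"
begin

sublocale \<phi>: group_hom "chains1 K r" "abelianization \<pi>" \<phi>
  by (intro group_hom.intro group_hom_axioms.intro hom_\<phi> ab.is_group) simp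

lemma \<phi>_add:
  "\<lbrakk>Poly_Mapping.keys x \<subseteq> simplices1 K r; Poly_Mapping.keys y \<subseteq> simplices1 K r\<rbrakk> \<Longrightarrow>
    \<phi> (x + y) = \<phi> x \<otimes>\<^bsub>abelianization \<pi>\<^esub> \<phi> y"
  using \<phi>.hom_mult[of x y] by simp

lemma \<phi>_diff:
  assumes "Poly_Mapping.keys x \<subseteq> simplices1 K r" "Poly_Mapping.keys y \<subseteq> simplices1 K r"
  shows "\<phi> (x - y) = \<phi> x \<otimes>\<^bsub>abelianization \<pi>\<^esub> inv\<^bsub>abelianization \<pi>\<^esub> \<phi> y"
  using \<phi>_add[of x "- y"] \<phi>.hom_inv[of y] assms by simp

text \<open>Addition of chains and concatenation of paths both turn into multiplication, so the
  prescribed values on single simplices propagate along \<open>p\<close>.\<close>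

lemma \<phi>_path_chain_close: "path K r p \<Longrightarrow> \<phi> (path_chain p) = ab_class (close_path p)"
proof (induction p)
  case (Cons b p)
  show ?case
  proof (cases "p = []")
    case True
    then show ?thesis using Cons.prems \<phi>_simplex by simp
  next
    case False
    then have "b \<in> simplices1 K r" "path K r p" "vert1 b = path_end p"
      using Cons.prems by simp_all
    then show ?thesis
      using Cons.IH ab_class_close_path_append[of "[b]" p]
      by (simp add: \<phi>_add keys_path_chain \<phi>_simplex)
  qed
qed (simp add: path_def)

lemma \<phi>_path_chain: "p \<in> loops K r a \<Longrightarrow> \<phi> (path_chain p) = ab_class p"
  using \<phi>_path_chain_close[of p] ab_class_close_path[of p] by (simp add: loops_iff)

lemma \<phi>_boundaries1:
  assumes "x \<in> boundaries1 K r"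
  shows "\<phi> x = \<one>\<^bsub>abelianization \<pi>\<^esub>"
  using assms
proof (induction rule: boundaries1_induct)
  case zero
  then show ?case using \<phi>.hom_one by simp
next
  case (face c)
  have p: "path K r [face0 c, face2 c]" "path K r [face1 c]"
    using face by (simp_all add: simplices2_def)
  \<comment> \<open>The boundary of \<open>c\<close> is read as a difference of the chains of two
    homotopic paths.\<close>
  have "\<phi> (path_chain [face0 c, face2 c]) = \<phi> (path_chain [face1 c])"
    using ab_class_homotopy[OF homotopy_close_path[OF homotopy_face[OF face]]]
    by (simp only: \<phi>_path_chain_close[OF p(1)] \<phi>_path_chain_close[OF p(2)])
  then have "\<phi> (path_chain [face0 c, face2 c] - path_chain [face1 c]) = \<one>\<^bsub>abelianization \<pi>\<^esub>"
    using keys_path_chain[OF p(1)] keys_path_chain[OF p(2)] \<phi>.hom_closed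
    by (simp add: \<phi>_diff)
  then show ?case by (simp add: algebra_simps)
next
  case (diff x y)
  then show ?case
    using boundaries1_subset_chains1[of K r] by (simp add: \<phi>_diff subset_iff)
qed

text \<open>The term involving \<open>\<gamma>\<close> makes the induction over arbitrary chains possible; it vanishes on
  cycles.\<close>

lemma chain_loop_representative:
  assumes "Poly_Mapping.keys z \<subseteq> simplices1 K r"
  shows "\<exists>p\<in>loops K r a. \<phi> z = ab_class p \<and>
    z - frag_extend (\<lambda>x. path_chain (\<gamma> x)) (boundary1 z) - path_chain p \<in> boundaries1 K r"
proof -
  let ?g = "\<lambda>z. frag_extend (\<lambda>x. path_chain (\<gamma> x)) (boundary1 z)"
  have "Poly_Mapping.keys z \<subseteq> simplices1 K r \<and> (\<exists>p\<in>loops K r a. \<phi> z = ab_class p \<and>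
    z - ?g z - path_chain p \<in> boundaries1 K r)"
    using assms
  proof (induction rule: frag_induction)
    case zero
    \<comment> \<open>The empty list is not a path, so the constant loop stands for 0; its chain is
      nonzero but a boundary.\<close>
    have "\<phi> 0 = ab_class [degen0 a]"
      using \<phi>.hom_one by (simp add: ab_class_degen0)
    moreover have "0 - ?g 0 - path_chain [degen0 a] \<in> boundaries1 K r"
      using boundaries1_minus[OF frag_of_degen0_boundary[OF base]] by (simp add: boundary1_def)
    ultimately show ?case
      using degen0_in_loops[OF base] by (metis empty_subsetI keys_zero)
  next
    case (one b)
    then show ?case
      using path_chain_close_path1[OF one] close_path_loop[of "[b]"] \<phi>_simplex[OF one]
      by auto
  next
    case (diff x y)
    then obtain p q where keys: "Poly_Mapping.keys x \<subseteq> simplices1 K r"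
        "Poly_Mapping.keys y \<subseteq> simplices1 K r"
      and p: "p \<in> loops K r a" "\<phi> x = ab_class p" "x - ?g x - path_chain p \<in> boundaries1 K r"
      and q: "q \<in> loops K r a" "\<phi> y = ab_class q" "y - ?g y - path_chain q \<in> boundaries1 K r"
      by auto
    \<comment> \<open>Subtraction of chains is modelled by appending the reverse loop; the defect
      \<open>path_chain (reverse_path q) + path_chain q\<close> is a boundary.\<close>
    have "\<phi> (x - y) = ab_class (p @ reverse_path q)"
      using keys p q
      by (simp add: \<phi>_diff ab_class_append loops_reverse_path ab_class_reverse_path)
    moreover have "x - y - ?g (x - y) - path_chain (p @ reverse_path q) \<in> boundaries1 K r"
    proof -
      have "(x - ?g x - path_chain p) - (y - ?g y - path_chain q)
          - (path_chain (reverse_path q) + path_chain q) \<in> boundaries1 K r"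
        using q by (intro boundaries1_diff[OF boundaries1_diff[OF p(3) q(3)]])
          (simp add: path_chain_reverse_path loops_iff)
      then show ?thesis
        by (simp add: boundary1_def frag_extend_diff algebra_simps)
    qed
    moreover have "p @ reverse_path q \<in> loops K r a"
      using p q by (simp add: loops_append loops_reverse_path)
    ultimately show ?case
      using keys keys_diff[of x y] by blast
  qed
  then show ?thesis ..
qed

section \<open>Kernel and image on cycles\<close>

lemma \<phi>_cycle_eq_one:
  assumes z: "z \<in> cycles1 K r" and one: "\<phi> z = \<one>\<^bsub>abelianization \<pi>\<^esub>"
  shows "z \<in> boundaries1 K r"
proof -
  \<comment> \<open>On a cycle the correction term is \<open>frag_extend\<close> applied to 0, so
    \<open>z\<close> is homologous to the chain of the loop.\<close>
  obtain p where p: "p \<in> loops K r a" "\<phi> z = ab_class p" "z - path_chain p \<in> boundaries1 K r"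
    using chain_loop_representative[of z] z by (auto simp: cycles1_iff)
  have "path_chain p \<in> boundaries1 K r"
    using p one by (intro path_chain_ab_class_one) simp_all
  from boundaries1_add[OF p(3) this] show ?thesis by simp
qed

text \<open>First isomorphism theorem for \<open>\<phi>\<close> restricted to cycles: its kernel is
  the group of boundaries, and chains of loops are cycles that already reach every class.\<close>

lemma net_homology1_iso: "net_homology1 K r \<cong> abelianization \<pi>"
proof -
  let ?Z = "(chains1 K r)\<lparr>carrier := cycles1 K r\<rparr>"
  have Z: "cycles1 K r \<subseteq> carrier (chains1 K r)"
    using subgroup_cycles1 by (rule subgroup.subset)
  interpret Z: group ?Z
    using subgroup_cycles1 by (rule \<phi>.G.subgroup_imp_group)
  interpret \<phi>Z: group_hom ?Z "abelianization \<pi>" \<phi>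
    by unfold_locales (use hom_\<phi> Z in \<open>auto simp: hom_def\<close>)
  have "kernel ?Z (abelianization \<pi>) \<phi> = boundaries1 K r"
    using \<phi>_cycle_eq_one \<phi>_boundaries1 boundaries1_subset_cycles1[of K r]
    by (auto simp: kernel_def)
  moreover have "\<phi> ` carrier ?Z = carrier (abelianization \<pi>)"
  proof
    show "\<phi> ` carrier ?Z \<subseteq> carrier (abelianization \<pi>)"
      using \<phi>Z.hom_closed by blast
    show "carrier (abelianization \<pi>) \<subseteq> \<phi> ` carrier ?Z"
    proof
      fix X assume "X \<in> carrier (abelianization \<pi>)"
      then obtain p where p: "p \<in> loops K r a" "X = ab_class p"
        by (auto simp: carrier_abelianization)
      then have "path_chain p \<in> cycles1 K r"
        by (simp add: cycles1_iff loops_iff keys_path_chain boundary1_path_chain[of K r])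
      with p show "X \<in> \<phi> ` carrier ?Z"
        by (auto simp flip: \<phi>_path_chain)
    qed
  qed
  ultimately show ?thesis
    using \<phi>Z.FactGroup_iso by (simp add: net_homology1_def)
qed

end

theorem theorem3p6:
  fixes K :: "'a set" and r :: "'a rel" and a :: 'a
  assumes "partial_order_on K r"
    and "pathwise_connected K r"
    and "a \<in> K"
  shows "net_homology1 K r \<cong> abelianization (homotopy_group K r a)"
proof -
  \<comment> \<open>Connectedness enters here, to supply the connectors from the base point.\<close>
  have "\<forall>x\<in>K. \<exists>p. path K r p \<and> path_start p = a \<and> path_end p = x"
    using assms(2,3) by (simp add: pathwise_connected_def)
  then obtain \<gamma> where "\<forall>x\<in>K. path K r (\<gamma> x) \<and> path_start (\<gamma> x) = a \<and> path_end (\<gamma> x) = x"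
    by metis
  then interpret based_poset K r a \<gamma>
    using assms(1,3) by unfold_locales auto
  have "(\<lambda>b. ab_class (close_path [b])) ` simplices1 K r \<subseteq> carrier (abelianization \<pi>)"
    using close_path_loop ab_class_closed by auto
  \<comment> \<open>Since the target is commutative, values prescribed on the generators extend to
    the free Abelian group.\<close>
  then obtain \<phi> where "\<phi> \<in> hom (chains1 K r) (abelianization \<pi>)"
    "\<And>b. b \<in> simplices1 K r \<Longrightarrow> \<phi> (frag_of b) = ab_class (close_path [b])"
    by (rule ab.free_Abelian_group_universal) (rule that)
  then interpret based_poset_hom K r a \<gamma> \<phi>
    by unfold_locales
  show ?thesis by (rule net_homology1_iso)
qed

end
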